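(* Let $F$ be an algebraically closed field of characteristic $p>0$, let $r\ge 1$, let $G=Z_{p^r}$ be the cyclic group of order $p^r$ with generator $\sigma$, and let $V=\bigoplus_{j=1}^k V_{n_j}$ (with $1\le n_j\le p^r$) be a $G$-module over $F$, with $F[V]=F[x_{i,j}\mid 1\le i\le n_j,\ 1\le j\le k]$, where $\sigma(x_{i,j})=x_{i,j}+x_{i-1,j}$ for $1<i\le n_j$ and $\sigma(x_{1,j})=x_{1,j}$ for $1\le j\le k$. For an integer $0\le s\le r$ define \[ J_s=\{j\in\{1,\ldots,k\}\mid n_j>p^{s-1}\}. \] Let $M=\prod_{1\le j\le k}x_{n_j,j}^{a_j}$ be a monomial consisting only of terminal variables, that appears in an invariant polynomial (an element of $F[V]^G$) with nonzero coefficient. Then $p^s$ divides $a_j$ for all $j\in J_s$.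
   Context: A $G$-module is a finite dimensional representation of $G$ over $F$. $G$ acts on the polynomial ring $F[V]$ (the symmetric algebra of $V^*$) by $\tau(f)=f\circ\tau^{-1}$, and $F[V]^G$ is the ring of invariants. $V_n$ ($1\le n\le p^r$) denotes the indecomposable $G$-module of dimension $n$ on which $\sigma^{-1}$ acts via a single Jordan block with eigenvalue $1$: each $V_{n_j}$ has a basis $e_{1,j},\ldots,e_{n_j,j}$ with $\sigma^{-1}(e_{i,j})=e_{i,j}+e_{i+1,j}$ for $1\le i<n_j$ and $\sigma^{-1}(e_{n_j,j})=e_{n_j,j}$, and $x_{1,j},\ldots,x_{n_j,j}$ is the corresponding dual basis. The variables $x_{n_j,j}$, $1\le j\le k$, are called terminal variables. For $s=0$, $p^{s-1}=1/p$. *)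

theory Defs
  imports
    "HOL-Library.Poly_Mapping"
    "HOL-Computational_Algebra.Polynomial"
    "HOL-Algebra.Generated_Groups"
begin

text \<open>
  Polynomials over \<open>'a\<close> in variables indexed by \<open>'x\<close>, as finitely supported maps from exponent
  vectors to coefficients; the product on the outer \<^type>\<open>poly_mapping\<close> is convolution.
\<close>

type_synonym ('x, 'a) mpoly = "('x \<Rightarrow>\<^sub>0 nat) \<Rightarrow>\<^sub>0 'a"

definition Const :: "'a::zero \<Rightarrow> ('x, 'a) mpoly" where
  "Const c = Poly_Mapping.single 0 c"

definition Var :: "'x \<Rightarrow> ('x, 'a::zero_neq_one) mpoly" where
  "Var q = Poly_Mapping.single (Poly_Mapping.single q 1) 1"

definition polys_in :: "'x set \<Rightarrow> ('x, 'a::zero) mpoly set" where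
  "polys_in I = {f. \<forall>m\<in>Poly_Mapping.keys f. Poly_Mapping.keys m \<subseteq> I}"

text \<open>The \<open>'a\<close>-algebra homomorphism sending each variable \<open>q\<close> to \<open>h q\<close>.\<close>

definition subst ::
    "('x \<Rightarrow> ('y, 'a) mpoly) \<Rightarrow> ('x, 'a::comm_ring_1) mpoly \<Rightarrow> ('y, 'a) mpoly" where
  "subst h f = (\<Sum>m\<in>Poly_Mapping.keys f. Const (Poly_Mapping.lookup f m) *
                  (\<Prod>q\<in>Poly_Mapping.keys m. h q ^ Poly_Mapping.lookup m q))"

lemma subst_Var: "subst h (Var q) = h q"
  by (simp add: subst_def Var_def Const_def)

text \<open>Finite-dimensional representations of \<open>G\<close> on the whole type \<open>'v\<close>.\<close>

locale G_module = group G + vector_space scale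
  for G (structure) and scale :: "'a::field \<Rightarrow> 'v::ab_group_add \<Rightarrow> 'v" +
  fixes \<rho> :: "'g \<Rightarrow> 'v \<Rightarrow> 'v"
  assumes finite_dim: "\<exists>B. finite B \<and> span B = UNIV"
    and rho_linear: "\<tau> \<in> carrier G \<Longrightarrow> Vector_Spaces.linear scale scale (\<rho> \<tau>)"
    and rho_one: "\<rho> \<one> = id"
    and rho_mult: "\<lbrakk>\<tau> \<in> carrier G; \<tau>' \<in> carrier G\<rbrakk> \<Longrightarrow> \<rho> (\<tau> \<otimes> \<tau>') = \<rho> \<tau> \<circ> \<rho> \<tau>'"
begin

definition basis_on :: "'i set \<Rightarrow> ('i \<Rightarrow> 'v) \<Rightarrow> bool" where
  "basis_on I e \<longleftrightarrow> inj_on e I \<and> independent (e ` I) \<and> span (e ` I) = UNIV"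

definition dual_basis :: "'i set \<Rightarrow> ('i \<Rightarrow> 'v) \<Rightarrow> 'i \<Rightarrow> 'v \<Rightarrow> 'a" where
  "dual_basis I e q v = representation (e ` I) v (e q)"

text \<open>
  Relative to a basis \<open>e\<close> indexed by the finite set \<open>I\<close>, the symmetric algebra of the dual of \<open>V\<close>
  is the polynomial ring in the dual basis, whose members \<^term>\<open>dual_basis I e q\<close> correspond to
  \<^term>\<open>Var q\<close>. A linear form \<open>l\<close> then corresponds to \<open>\<Sum>q\<in>I. l (e q) \<cdot> Var q\<close>, and \<open>\<tau>\<close> acts
  as the algebra homomorphism extending \<open>l \<mapsto> l \<circ> \<rho> (inv \<tau>)\<close>.
\<close>

definition linear_form :: "'i set \<Rightarrow> ('i \<Rightarrow> 'v) \<Rightarrow> ('v \<Rightarrow> 'a) \<Rightarrow> ('i, 'a) mpoly" where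
  "linear_form I e l = (\<Sum>q\<in>I. Const (l (e q)) * Var q)"

definition poly_action ::
    "'i set \<Rightarrow> ('i \<Rightarrow> 'v) \<Rightarrow> 'g \<Rightarrow> ('i, 'a) mpoly \<Rightarrow> ('i, 'a) mpoly" where
  "poly_action I e \<tau> = subst (\<lambda>q. linear_form I e (dual_basis I e q \<circ> \<rho> (inv \<tau>)))"

definition invariants :: "'i set \<Rightarrow> ('i \<Rightarrow> 'v) \<Rightarrow> ('i, 'a) mpoly set" where
  "invariants I e = {f \<in> polys_in I. \<forall>\<tau>\<in>carrier G. poly_action I e \<tau> f = f}"

end

text \<open>The pair \<open>(i, j)\<close> indexes the \<open>i\<close>-th basis vector of the \<open>j\<close>-th summand.\<close>

definition block_index :: "nat \<Rightarrow> (nat \<Rightarrow> nat) \<Rightarrow> (nat \<times> nat) set" where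
  "block_index k n = {(i, j). 1 \<le> j \<and> j \<le> k \<and> 1 \<le> i \<and> i \<le> n j}"

text \<open>
  \<open>V\<close> is the direct sum of the spans of \<open>e (1, j), \<dots>, e (n j, j)\<close> for \<open>1 \<le> j \<le> k\<close>, and
  \<open>\<sigma>\<inverse>\<close> acts on each of them by a single Jordan block.
\<close>

definition (in G_module) jordan_basis ::
    "'g \<Rightarrow> nat \<Rightarrow> (nat \<Rightarrow> nat) \<Rightarrow> (nat \<times> nat \<Rightarrow> 'v) \<Rightarrow> bool" where
  "jordan_basis \<sigma> k n e \<longleftrightarrow> basis_on (block_index k n) e \<and>
     (\<forall>j\<in>{1..k}.
        (\<forall>i. 1 \<le> i \<and> i < n j \<longrightarrow> \<rho> (inv \<sigma>) (e (i, j)) = e (i, j) + e (i + 1, j)) \<and>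
        \<rho> (inv \<sigma>) (e (n j, j)) = e (n j, j))"

definition J :: "nat \<Rightarrow> nat \<Rightarrow> (nat \<Rightarrow> nat) \<Rightarrow> nat \<Rightarrow> nat set" where
  "J p k n s = {j \<in> {1..k}. real (n j) > real p powi (int s - 1)}"

text \<open>Exponent vector of the product of the \<open>x\<^bsub>n j, j\<^esub>\<close> raised to the powers \<open>a j\<close>.\<close>

definition terminal_monomial :: "nat \<Rightarrow> (nat \<Rightarrow> nat) \<Rightarrow> (nat \<Rightarrow> nat) \<Rightarrow> (nat \<times> nat \<Rightarrow>\<^sub>0 nat)" where
  "terminal_monomial k n a = (\<Sum>j\<in>{1..k}. Poly_Mapping.single (n j, j) (a j))"

lemma finite_block_index: "finite (block_index k n)"
proof -
  have "block_index k n = (\<Union>j\<in>{1..k}. (\<lambda>i. (i, j)) ` {1..n j})"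
    by (auto simp: block_index_def)
  then show ?thesis by simp
qed

text \<open>The action of \<open>\<sigma>\<close> on the variables.\<close>

lemma (in G_module) poly_action_Var:
  assumes jb: "jordan_basis \<sigma> k n e" and ij: "(i, j) \<in> block_index k n"
  shows "poly_action (block_index k n) e \<sigma> (Var (i, j)) =
           (if i = 1 then Var (i, j) else Var (i, j) + Var (i - 1, j))"
proof -
  let ?I = "block_index k n"
  have inj: "inj_on e ?I" and ind: "independent (e ` ?I)"
    using jb by (auto simp: jordan_basis_def basis_on_def)
  have dual: "dual_basis ?I e q (e q') = (if q' = q then 1 else 0)"
    if "q \<in> ?I" "q' \<in> ?I" for q q'
    using that inj representation_basis[OF ind, of "e q'"]
    by (auto simp: dual_basis_def inj_on_eq_iff)
  have add: "dual_basis ?I e q (u + v) = dual_basis ?I e q u + dual_basis ?I e q v" for q u v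
  proof -
    have "span (e ` ?I) = UNIV"
      using jb by (simp add: jordan_basis_def basis_on_def)
    then have "representation (e ` ?I) (u + v) =
        (\<lambda>b. representation (e ` ?I) u b + representation (e ` ?I) v b)"
      by (intro representation_add[OF ind]) simp_all
    then show ?thesis
      by (simp add: dual_basis_def)
  qed
  have val: "dual_basis ?I e (i, j) (\<rho> (inv \<sigma>) (e q)) =
      (if q = (i, j) then 1 else if q = (i - 1, j) then 1 else 0)" if q: "q \<in> ?I" for q
  proof -
    obtain i' j' where q': "q = (i', j')" by (cases q)
    have b: "1 \<le> j'" "j' \<le> k" "1 \<le> i'" "i' \<le> n j'"
      using q by (auto simp: q' block_index_def)
    show ?thesis
    proof (cases "i' < n j'")
      case True
      have "(i' + 1, j') \<in> ?I" using True b by (auto simp: block_index_def)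
      moreover have "\<rho> (inv \<sigma>) (e q) = e q + e (i' + 1, j')"
        using jb True b by (auto simp: jordan_basis_def q')
      ultimately show ?thesis
        using q ij b by (auto simp: add dual q')
    next
      case False
      then have "i' = n j'" using b by simp
      moreover have "\<rho> (inv \<sigma>) (e (n j', j')) = e (n j', j')"
        using jb b by (auto simp: jordan_basis_def)
      ultimately have "\<rho> (inv \<sigma>) (e q) = e q" by (simp add: q')
      moreover have "i \<le> n j" "1 \<le> i" using ij by (auto simp: block_index_def)
      ultimately show ?thesis
        using q ij b \<open>i' = n j'\<close> by (auto simp: dual q')
    qed
  qed
  have c: "Const 0 = (0 :: (nat \<times> nat, 'a) mpoly)" "Const 1 = (1 :: (nat \<times> nat, 'a) mpoly)"
    by (simp_all add: Const_def)
  have "poly_action ?I e \<sigma> (Var (i, j)) =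
      (\<Sum>q\<in>?I. Const (dual_basis ?I e (i, j) (\<rho> (inv \<sigma>) (e q))) * Var q)"
    by (simp add: poly_action_def subst_Var linear_form_def)
  also have "\<dots> = (\<Sum>q\<in>?I. (if q = (i, j) then Var q else 0) + (if q = (i - 1, j) then Var q else 0))"
  proof (rule sum.cong)
    fix q assume q: "q \<in> ?I"
    have "1 \<le> i" using ij by (auto simp: block_index_def)
    then show "Const (dual_basis ?I e (i, j) (\<rho> (inv \<sigma>) (e q))) * Var q =
      (if q = (i, j) then Var q else 0) + (if q = (i - 1, j) then Var q else 0)"
      by (auto simp: val[OF q] c)
  qed simp
  also have "\<dots> = Var (i, j) + (if (i - 1, j) \<in> ?I then Var (i - 1, j) else 0)"
    using ij by (simp add: sum.distrib finite_block_index)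
  finally show ?thesis
    using ij by (auto simp: block_index_def)
qed

end

theory Submission
  imports Defs "HOL-Algebra.Exponent"
begin

text \<open>
  A monomial in the terminal variables is seen by restricting \<open>f\<close> to the fixed space of \<open>A = \<sigma>\<inverse>\<close>.
  The heart of the proof is that, if \<open>A v = v\<close>, \<open>A e = e\<close> and \<open>e\<close> is \<open>A - 1\<close> applied \<open>d\<close> times
  to some \<open>w\<close>, with \<open>d\<close> the \<open>t\<close>-th power of \<open>p\<close> (for the last vector of a block of length \<open>n\<close>
  this needs \<open>n > d\<close>), then \<open>f(v + s e)\<close> is a polynomial in the \<open>pd\<close>-th power of \<open>s\<close>. This goes by
  induction on \<open>t\<close>. Let \<open>u\<close> be \<open>A - 1\<close> applied \<open>d - 1\<close> times to \<open>w\<close>, so \<open>A u = u + e\<close>. If \<open>t > 0\<close>, the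
  \<open>p\<close>-th power of \<open>A\<close> fixes \<open>v + T u\<close>, and its difference with \<open>1\<close> is the \<open>p\<close>-th power of \<open>A - 1\<close>;
  so the induction hypothesis makes \<open>f(v + T u + S e)\<close> a polynomial in the \<open>d\<close>-th power of \<open>S\<close>.
  Invariance gives \<open>f(v + T u + T e) = f(v + T u)\<close>, and comparing the terms of degree \<open>d\<close> in \<open>T\<close>
  shows that \<open>f(v + S e)\<close> has no term of degree \<open>d\<close> in \<open>S\<close>. As this holds for \<open>v + c e\<close> for every
  \<open>c\<close>, and \<open>p\<close> does not divide \<open>dm\<close> choose \<open>d\<close> unless it divides \<open>m\<close>, only exponents divisible by
  \<open>pd\<close> survive.
\<close>

subsection \<open>Polynomials over infinite fields\<close>

text \<open>In a finite field, 1 plus the product of all X - c takes the value 1 everywhere, so it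
  has no root; yet its degree is the size of the field, which is positive.\<close>

lemma alg_closed_infinite: "infinite (UNIV :: 'a::alg_closed_field set)"
proof
  assume fin: "finite (UNIV :: 'a set)"
  define P :: "'a poly" where "P = (\<Prod>c\<in>UNIV. [:- c, 1:]) + 1"
  have root: "poly P x = 1" for x
    using fin by (simp add: P_def poly_prod prod_zero[of UNIV] exI[of _ x])
  then have "degree P = 0"
    using alg_closed_imp_poly_has_root[of P] by fastforce
  moreover have "degree (\<Prod>c\<in>(UNIV :: 'a set). [:- c, 1:]) = card (UNIV :: 'a set)"
    by (subst degree_prod_sum_eq) auto
  moreover have "card (UNIV :: 'a set) > 0"
    using fin by (simp add: card_gt_0_iff)
  ultimately show False
    unfolding P_def by (metis degree_1 degree_add_eq_left less_numeral_extra(3))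
qed

lemma poly_eqI_infinite_field:
  fixes P Q :: "'a::field poly"
  assumes "infinite (UNIV :: 'a set)" and "\<And>x. poly P x = poly Q x"
  shows "P = Q"
  using poly_roots_finite[of "P - Q"] assms by (cases "P = Q") auto

lemma coeff_sum_monom_fun:
  assumes "finite K"
  shows "coeff (\<Sum>m\<in>K. monom (c m) (d m)) i = (\<Sum>m\<in>{m\<in>K. d m = i}. c m)"
  using assms by (simp add: coeff_sum sum.If_cases Int_def)

text \<open>Comparison of coefficients, one variable at a time: with the other values frozen, the
  sum is a polynomial in \<open>x q\<close> that vanishes on an infinite field, so its part of each
  degree in \<open>x q\<close> vanishes. A sum remains because members of \<open>K\<close> may
  differ outside \<open>Q\<close>.\<close>

lemma sum_monomials_eq_0:
  fixes c :: "('x \<Rightarrow>\<^sub>0 nat) \<Rightarrow> 'a::field"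
  assumes inf: "infinite (UNIV :: 'a set)" and "finite Q" "finite K"
    and "\<And>x. (\<Sum>m\<in>K. c m * (\<Prod>q\<in>Q. x q ^ Poly_Mapping.lookup m q)) = 0"
  shows "(\<Sum>m\<in>{m\<in>K. \<forall>q\<in>Q. Poly_Mapping.lookup m q = Poly_Mapping.lookup m0 q}. c m) = 0"
  using assms(2-)
proof (induction Q arbitrary: K rule: finite_induct)
  case (insert q Q)
  let ?mon = "\<lambda>x m. \<Prod>q\<in>Q. x q ^ Poly_Mapping.lookup m q"
  define K' where "K' = {m\<in>K. Poly_Mapping.lookup m q = Poly_Mapping.lookup m0 q}"
  have "(\<Sum>m\<in>K'. c m * ?mon x m) = 0" for x
  proof -
    define P where "P = (\<Sum>m\<in>K. monom (c m * ?mon x m) (Poly_Mapping.lookup m q))"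
    have "poly P y = 0" for y
    proof -
      have "?mon (x(q := y)) m = ?mon x m" for m
        using insert.hyps by (intro prod.cong) auto
      then show ?thesis
        using insert.prems(2)[of "x(q := y)"] insert.hyps
        by (simp add: P_def poly_sum poly_monom mult_ac)
    qed
    then have "P = 0"
      using inf by (intro poly_eqI_infinite_field) auto
    then show ?thesis
      using coeff_sum_monom_fun[OF insert.prems(1),
          of "\<lambda>m. c m * ?mon x m" "\<lambda>m. Poly_Mapping.lookup m q" "Poly_Mapping.lookup m0 q"]
      by (simp add: P_def K'_def)
  qed
  then have "(\<Sum>m\<in>{m\<in>K'. \<forall>q\<in>Q. Poly_Mapping.lookup m q = Poly_Mapping.lookup m0 q}. c m) = 0"
    using insert.IH[of K'] insert.prems(1) by (simp add: K'_def)
  then show ?case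
    by (simp add: K'_def conj_ac)
qed simp

subsection \<open>Evaluation of multivariate polynomials\<close>

definition meval :: "('x \<Rightarrow> 'a::comm_ring_1) \<Rightarrow> ('x, 'a) mpoly \<Rightarrow> 'a" where
  "meval x f = (\<Sum>m\<in>Poly_Mapping.keys f. Poly_Mapping.lookup f m *
                  (\<Prod>q\<in>Poly_Mapping.keys m. x q ^ Poly_Mapping.lookup m q))"

lemma monomial_superset:
  assumes "finite S" "Poly_Mapping.keys m \<subseteq> S"
  shows "(\<Prod>q\<in>Poly_Mapping.keys m. x q ^ Poly_Mapping.lookup m q :: 'a::comm_ring_1) =
         (\<Prod>q\<in>S. x q ^ Poly_Mapping.lookup m q)"
  using assms by (intro prod.mono_neutral_left) (auto simp: in_keys_iff)

lemma monomial_add: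
  "(\<Prod>q\<in>Poly_Mapping.keys (m + m'). x q ^ Poly_Mapping.lookup (m + m') q :: 'a::comm_ring_1) =
   (\<Prod>q\<in>Poly_Mapping.keys m. x q ^ Poly_Mapping.lookup m q) *
   (\<Prod>q\<in>Poly_Mapping.keys m'. x q ^ Poly_Mapping.lookup m' q)"
proof -
  let ?S = "Poly_Mapping.keys m \<union> Poly_Mapping.keys m'"
  show ?thesis
    using monomial_superset[of ?S "m + m'" x] monomial_superset[of ?S m x]
      monomial_superset[of ?S m' x] Poly_Mapping.keys_add[of m m']
    by (simp add: lookup_add power_add prod.distrib)
qed

lemma meval_superset:
  assumes "finite S" "Poly_Mapping.keys f \<subseteq> S"
  shows "meval x f = (\<Sum>m\<in>S. Poly_Mapping.lookup f m *
                        (\<Prod>q\<in>Poly_Mapping.keys m. x q ^ Poly_Mapping.lookup m q))"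
  unfolding meval_def using assms by (intro sum.mono_neutral_left) (auto simp: in_keys_iff)

lemma meval_add: "meval x (f + g) = meval x f + meval x g"
proof -
  let ?S = "Poly_Mapping.keys f \<union> Poly_Mapping.keys g"
  show ?thesis
    using meval_superset[of ?S "f + g" x] meval_superset[of ?S f x]
      meval_superset[of ?S g x] Poly_Mapping.keys_add[of f g]
    by (simp add: lookup_add distrib_right sum.distrib)
qed

lemma meval_zero [simp]: "meval x 0 = 0"
  by (simp add: meval_def)

lemma meval_sum: "meval x (\<Sum>i\<in>S. f i) = (\<Sum>i\<in>S. meval x (f i))"
  by (induction S rule: infinite_finite_induct) (simp_all add: meval_add)

lemma meval_single:
  "meval x (Poly_Mapping.single m c) =
     c * (\<Prod>q\<in>Poly_Mapping.keys m. x q ^ Poly_Mapping.lookup m q)"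
  by (simp add: meval_def)

lemma meval_Const [simp]: "meval x (Const c) = c"
  by (simp add: Const_def meval_single)

lemma meval_Var [simp]: "meval x (Var q) = x q"
  by (simp add: Var_def meval_single)

lemma mpoly_sum_single:
  "f = (\<Sum>m\<in>Poly_Mapping.keys f. Poly_Mapping.single m (Poly_Mapping.lookup f m))"
  by (rule poly_mapping_eqI) (simp add: lookup_sum lookup_single when_def in_keys_iff)

lemma meval_mult: "meval x (f * g) = meval x f * meval x g"
proof -
  have "f * g = (\<Sum>m\<in>Poly_Mapping.keys f. \<Sum>m'\<in>Poly_Mapping.keys g.
      Poly_Mapping.single (m + m') (Poly_Mapping.lookup f m * Poly_Mapping.lookup g m'))"
    by (subst mpoly_sum_single[of f], subst mpoly_sum_single[of g])
      (simp add: sum_product mult_single)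
  then have "meval x (f * g) = meval x \<dots>"
    by (rule arg_cong)
  then show ?thesis
    by (simp add: meval_sum meval_single monomial_add meval_def[of x f] meval_def[of x g]
        sum_product mult_ac)
qed

lemma meval_one [simp]: "meval x 1 = 1"
  using meval_Const[of x 1] by (simp add: Const_def)

lemma meval_power: "meval x (f ^ i) = meval x f ^ i"
  by (induction i) (simp_all add: meval_mult)

lemma meval_prod: "meval x (\<Prod>i\<in>S. f i) = (\<Prod>i\<in>S. meval x (f i))"
  by (induction S rule: infinite_finite_induct) (simp_all add: meval_mult)

lemma meval_subst: "meval x (subst h f) = meval (\<lambda>q. meval x (h q)) f"
  by (simp add: subst_def meval_sum meval_mult meval_prod meval_power)
    (simp add: meval_def)

subsection \<open>Invariant functions along fixed directions\<close>

text \<open>Being polynomial on every affine plane is all that the divisibility argument asks of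
  \<open>g\<close>, which keeps it free of coordinates. The outer variable of \<open>Q\<close> is
  \<open>s\<close>, and its coefficients are polynomials in \<open>t\<close>.\<close>

definition polynomial_fun :: "('a::field \<Rightarrow> 'b::ab_group_add \<Rightarrow> 'b) \<Rightarrow> ('b \<Rightarrow> 'a) \<Rightarrow> bool" where
  "polynomial_fun scale g \<longleftrightarrow>
     (\<forall>v u e. \<exists>Q. \<forall>t s. g (v + scale t u + scale s e) = poly (poly Q [:s:]) t)"

context vector_space
begin

text \<open>The binomial theorem for \<open>A\<close> = 1 + (\<open>A\<close> - 1), whose summands
  commute; the induction step is Pascal's rule.\<close>

lemma funpow_eq_sum_binomial:
  assumes "Vector_Spaces.linear scale scale A"
  shows "(A ^^ n) x = (\<Sum>k\<le>n. scale (of_nat (n choose k)) (((\<lambda>x. A x - x) ^^ k) x))"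
proof (induction n)
  case (Suc n)
  interpret A: Vector_Spaces.linear scale scale A by fact
  define z where "z k = ((\<lambda>x. A x - x) ^^ k) x" for k
  have A: "A (z k) = z k + z (Suc k)" for k
    by (simp add: z_def)
  have "(A ^^ n) x = (\<Sum>k\<le>n. scale (of_nat (n choose k)) (z k))"
    using Suc by (simp only: z_def)
  then have "(A ^^ Suc n) x = (\<Sum>k\<le>n. scale (of_nat (n choose k)) (z k)) +
      (\<Sum>k\<le>n. scale (of_nat (n choose k)) (z (Suc k)))"
    by (simp add: A.sum A.scale A scale_right_distrib sum.distrib)
  also have "(\<Sum>k\<le>n. scale (of_nat (n choose k)) (z k)) =
      (\<Sum>k\<le>Suc n. scale (of_nat (n choose k)) (z k))"
    by (simp add: binomial_eq_0)
  also have "\<dots> = z 0 + (\<Sum>k\<le>n. scale (of_nat (n choose Suc k)) (z (Suc k)))"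
    by (subst sum.atMost_Suc_shift) simp
  also have "\<dots> + (\<Sum>k\<le>n. scale (of_nat (n choose k)) (z (Suc k))) =
      (\<Sum>k\<le>Suc n. scale (of_nat (Suc n choose k)) (z k))"
    by (subst sum.atMost_Suc_shift) (simp add: scale_left_distrib sum.distrib add_ac)
  finally show ?case
    by (simp only: z_def)
qed simp

text \<open>The inner binomial coefficients of \<open>p\<close> vanish in characteristic
  \<open>p\<close>.\<close>

lemma funpow_prime_char:
  assumes "Vector_Spaces.linear scale scale A" and "prime p" and "CHAR('a) = p"
  shows "(A ^^ p) x = x + ((\<lambda>x. A x - x) ^^ p) x"
proof -
  have p: "p > 0" using \<open>prime p\<close> by (rule prime_gt_0_nat)
  have "of_nat (p choose k) = (0 :: 'a)" if "k \<notin> {0, p}" "k \<le> p" for k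
    using that assms dvd_choose_prime[of k p] by (simp add: of_nat_eq_0_iff_char_dvd)
  then have "(A ^^ p) x =
      (\<Sum>k\<in>{0, p}. scale (of_nat (p choose k)) (((\<lambda>x. A x - x) ^^ k) x))"
    unfolding funpow_eq_sum_binomial[OF assms(1)] by (intro sum.mono_neutral_right) auto
  then show ?thesis
    using p by simp
qed

lemma linear_funpow:
  assumes "Vector_Spaces.linear scale scale A"
  shows "Vector_Spaces.linear scale scale (A ^^ n)"
proof (induction n)
  case 0
  show ?case using linear_id by (simp add: id_def)
next
  case (Suc n)
  show ?case
    using Vector_Spaces.linear_compose[OF Suc assms] by (simp only: funpow.simps)
qed

text \<open>Write g(v + t u + s e) as the sum of q_i(t) s^i. Since \<open>A\<close> sends v + t u to
  v + t u + t e, invariance says that the sum of q_i(t) t^i equals q_0(t). By \<open>dvd\<close>,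
  q_i = 0 unless \<open>d\<close> divides i, so in degree \<open>d\<close> only q_0 and the constant
  term of q_d contribute to the left side. Hence q_d(0) = 0, and this is the coefficient of
  \<open>P\<close> in question.\<close>

lemma coeff_fixed_direction_eq_0:
  fixes g :: "'b \<Rightarrow> 'a" and d :: nat
  assumes inf: "infinite (UNIV :: 'a set)" and g: "polynomial_fun scale g"
    and A: "Vector_Spaces.linear scale scale A" and inv: "\<And>x. g (A x) = g x"
    and Au: "A u = u + e" and Av: "A v = v" and d: "d > 0"
    and dvd: "\<And>t P i. (\<And>s. g (v + scale t u + scale s e) = poly P s) \<Longrightarrow> coeff P i \<noteq> 0 \<Longrightarrow> d dvd i"
    and P: "\<And>s. g (v + scale s e) = poly P s"
  shows "coeff P d = 0"
proof -
  interpret A: Vector_Spaces.linear scale scale A by fact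
  obtain Q where Q: "\<And>t s. g (v + scale t u + scale s e) = poly (poly Q [:s:]) t"
    using g unfolding polynomial_fun_def by blast
  define R where "R t = map_poly (\<lambda>c. poly c t) Q" for t
  have "poly (R t) s = poly (poly Q [:s:]) t" for t s
  proof -
    have "poly (poly Q [:s:]) t = (\<Sum>i\<le>degree Q. poly (coeff Q i) t * s ^ i)"
      by (simp add: poly_altdef[of Q] poly_sum)
    also have "\<dots> = (\<Sum>i\<le>degree (R t). coeff (R t) i * s ^ i)"
      using map_poly_degree_leq[of "\<lambda>c. poly c t" Q] coeff_eq_0[of "R t"]
      by (intro sum.mono_neutral_cong_right) (auto simp: R_def coeff_map_poly not_le)
    finally show ?thesis by (simp add: poly_altdef)
  qed
  then have R: "g (v + scale t u + scale s e) = poly (R t) s" for t s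
    by (simp add: Q)
  have Q0: "coeff Q i = 0" if "\<not> d dvd i" for i
  proof (rule poly_eqI_infinite_field[OF inf])
    fix t show "poly (coeff Q i) t = poly 0 t"
      using dvd[of t "R t" i] R that by (auto simp: R_def coeff_map_poly)
  qed
  \<comment> \<open>Putting the inner variable for the outer one restricts to the diagonal s = t,
    while \<open>coeff Q 0\<close> is the restriction to s = 0.\<close>
  have "poly Q [:0, 1:] = coeff Q 0"
  proof (rule poly_eqI_infinite_field[OF inf])
    fix t
    have "poly (poly Q [:0, 1:]) t = poly (poly Q [:t:]) t"
      by (simp add: poly_altdef[of Q] poly_sum)
    also have "\<dots> = g (A (v + scale t u))"
      by (simp add: Q[symmetric] A.add A.scale Au Av scale_right_distrib add_ac)
    also have "\<dots> = poly (poly Q [:0:]) t"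
      using Q[of t 0] by (simp add: inv)
    finally show "poly (poly Q [:0, 1:]) t = poly (coeff Q 0) t"
      by (simp add: poly_0_coeff_0)
  qed
  then have "coeff (coeff Q 0) d = coeff (poly Q [:0, 1:]) d"
    by simp
  also have "\<dots> = (\<Sum>i\<le>degree Q. if i \<le> d then coeff (coeff Q i) (d - i) else 0)"
  proof -
    have "[:0, 1:] ^ i = monom (1 :: 'a) i" for i
      by (simp add: monom_altdef)
    then have "coeff (coeff Q i * [:0, 1:] ^ i) d =
        (if i \<le> d then coeff (coeff Q i) (d - i) else 0)" for i
      by (simp add: mult.commute[of "coeff Q i"] coeff_monom_mult not_less)
    then show ?thesis
      by (simp only: poly_altdef coeff_sum)
  qed
  also have "\<dots> = (\<Sum>i\<in>{0, d}. coeff (coeff Q i) (d - i))"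
  proof -
    have "coeff Q i = 0" if "0 < i" "i \<noteq> d" "i \<le> d" for i
      using that Q0[of i] by (meson dvd_imp_le le_antisym)
    then show ?thesis
      using d by (intro sum.mono_neutral_cong) (auto simp: coeff_eq_0)
  qed
  finally have "coeff (coeff Q d) 0 = 0"
    using d by simp
  moreover have "P = R 0"
    using P R[of 0] by (intro poly_eqI_infinite_field[OF inf]) simp
  ultimately show ?thesis
    by (simp add: R_def coeff_map_poly poly_0_coeff_0)
qed

text \<open>One gain of a factor \<open>p\<close>, shared by the base case and the inductive step
  below: \<open>dvd\<close> stands for what is already known along \<open>e\<close>. It ranges over
  all fixed \<open>v\<close> because the base point is moved to v + c e.\<close>

lemma dvd_exponent_step:
  fixes g :: "'b \<Rightarrow> 'a" and t :: nat
  assumes inf: "infinite (UNIV :: 'a set)" and p: "prime p" "CHAR('a) = p"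
    and g: "polynomial_fun scale g"
    and A: "Vector_Spaces.linear scale scale A" and inv: "\<And>x. g (A x) = g x"
    and Au: "A u = u + e" and Ae: "A e = e" and Av: "A v = v"
    and dvd: "\<And>v T P i. A v = v \<Longrightarrow> (\<And>s. g (v + scale T u + scale s e) = poly P s) \<Longrightarrow>
                coeff P i \<noteq> 0 \<Longrightarrow> p ^ t dvd i"
    and P: "\<And>s. g (v + scale s e) = poly P s" and i: "coeff P i \<noteq> 0"
  shows "p ^ Suc t dvd i"
proof -
  interpret A: Vector_Spaces.linear scale scale A by fact
  define d where "d = p ^ t"
  have d: "d > 0"
    using p(1) by (simp add: d_def prime_gt_0_nat)
  \<comment> \<open>The coefficient of degree \<open>d\<close> of \<open>P(c + X)\<close>, as a polynomial in \<open>c\<close>.\<close>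
  define H where "H = (\<Sum>i\<le>degree P. monom (coeff P i * of_nat (i choose d)) (i - d))"
  have "H = 0"
  proof (rule poly_eqI_infinite_field[OF inf])
    fix c
    \<comment> \<open>The Taylor shift P(c + X), which describes \<open>g\<close> along
      \<open>e\<close> from the base point v + c e.\<close>
    define P' where "P' = (\<Sum>i\<le>degree P. smult (coeff P i) ([:c, 1:] ^ i))"
    have fixed: "A (v + scale c e) = v + scale c e"
      by (simp add: A.add A.scale Av Ae)
    have P': "g (v + scale c e + scale s e) = poly P' s" for s
      using P[of "c + s"]
      by (simp add: scale_left_distrib add.assoc P'_def poly_sum poly_altdef[of P])
    have "coeff P' d = 0"
      by (rule coeff_fixed_direction_eq_0[OF inf g A inv Au fixed d dvd[OF fixed, folded d_def] P'])
    moreover have "coeff P i * coeff ([:c, 1:] ^ i) d =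
        coeff P i * of_nat (i choose d) * c ^ (i - d)" for i
    proof (cases "d \<le> i")
      case True
      then show ?thesis by (simp add: coeff_linear_poly_power)
    next
      case False
      then have "degree ([:c, 1:] ^ i) < d"
        using degree_power_le[of "[:c, 1:]" i] by simp
      then show ?thesis using False by (simp add: coeff_eq_0 binomial_eq_0)
    qed
    ultimately show "poly H c = poly 0 c"
      by (simp add: P'_def H_def coeff_sum poly_sum poly_monom)
  qed
  have "d dvd i"
    using dvd[OF Av, of 0 P i] P i by (simp add: d_def)
  then obtain m where m: "i = d * m" ..
  show ?thesis
  proof (rule ccontr)
    assume "\<not> ?thesis"
    then have pm: "\<not> p dvd m"
      using d by (auto simp: m d_def[symmetric] mult.commute)
    then have "m > 0" by (cases m) auto
    then have "d \<le> i" using m by simp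
    \<comment> \<open>For j < d the truncated difference j - d is 0 and may coincide with i - d, but
      then j choose d is 0; so only j = i contributes.\<close>
    have "coeff H (i - d) =
        (\<Sum>j\<le>degree P. if j = i then coeff P i * of_nat (i choose d) else 0)"
      unfolding H_def coeff_sum using \<open>d \<le> i\<close> by (intro sum.cong) (auto simp: binomial_eq_0)
    also have "\<dots> = coeff P i * of_nat (i choose d)"
      using le_degree[OF i] by simp
    finally have "of_nat (i choose d) = (0 :: 'a)"
      using i \<open>H = 0\<close> by simp
    then have "p dvd p ^ t * m choose p ^ t"
      using p by (simp add: of_nat_eq_0_iff_char_dvd m d_def)
    \<comment> \<open>The counting fact known from Sylow's theorem: this binomial coefficient has
      the same \<open>p\<close>-adic valuation as \<open>m\<close>.\<close>
    moreover have "multiplicity p (p ^ t * m choose p ^ t) = 0"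
      using const_p_fac[OF \<open>m > 0\<close> p(1)] pm by (simp add: not_dvd_imp_multiplicity_0)
    moreover have "(p ^ t * m choose p ^ t) > 0"
      using \<open>d \<le> i\<close> unfolding m d_def by (rule zero_less_binomial)
    ultimately show False
      using p(1) by (metis less_irrefl multiplicity_eq_zero_iff not_prime_unit)
  qed
qed

text \<open>The induction must generalize over \<open>A\<close>, since it passes from
  \<open>A\<close> to \<open>A ^^ p\<close>; \<open>e\<close> and \<open>w\<close> stay the same,
  because \<open>p ^ t\<close> applications of (A ^^ p) - 1 are \<open>p ^ Suc t\<close>
  applications of A - 1.\<close>

lemma dvd_exponent_fixed_direction:
  fixes g :: "'b \<Rightarrow> 'a" and A :: "'b \<Rightarrow> 'b"
  assumes inf: "infinite (UNIV :: 'a set)" and p: "prime p" "CHAR('a) = p"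
    and g: "polynomial_fun scale g"
    and "Vector_Spaces.linear scale scale A" and "\<And>x. g (A x) = g x"
    and "e = ((\<lambda>x. A x - x) ^^ (p ^ t)) w" and "A e = e" and "A v = v"
    and "\<And>s. g (v + scale s e) = poly P s" and "coeff P i \<noteq> 0"
  shows "p ^ Suc t dvd i"
  using assms(5-)
proof (induction t arbitrary: A v P i)
  case 0
  \<comment> \<open>Here \<open>u\<close> is \<open>w\<close> itself, and the divisibility asked for
    by \<open>dvd\<close> is by \<open>p ^ 0\<close>, which is trivial.\<close>
  show ?case
    by (rule dvd_exponent_step[OF inf p g 0(1,2), of w e v 0]) (use 0 in auto)
next
  case (Suc t)
  let ?D = "\<lambda>x. A x - x"
  interpret A: Vector_Spaces.linear scale scale A by fact
  define u where "u = (?D ^^ (p ^ Suc t - 1)) w"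
  have "p > 0" using p(1) by (rule prime_gt_0_nat)
  then have pt: "Suc (p ^ Suc t - 1) = p ^ Suc t" by simp
  have "?D u = (?D ^^ Suc (p ^ Suc t - 1)) w"
    by (simp only: u_def funpow.simps o_apply)
  then have "?D u = e"
    by (simp only: pt Suc.prems(3))
  then have Au: "A u = u + e" by (simp add: algebra_simps)
  have fixed: "(A ^^ n) x = x" if "A x = x" for n x
    using that by (induction n) auto
  \<comment> \<open>For n = p the multiple of \<open>e\<close> vanishes, so \<open>A ^^ p\<close>
    fixes \<open>u\<close> and with it every v + T u; these are the base points for the induction
    hypothesis.\<close>
  have "(A ^^ n) u = u + scale (of_nat n) e" for n
    by (induction n) (simp_all add: A.add A.scale Au Suc.prems(4) scale_left_distrib add_ac)
  then have Apu: "(A ^^ p) u = u"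
    using p(2) by (metis add.right_neutral of_nat_CHAR scale_zero_left)
  have inv: "g ((A ^^ n) x) = g x" for n x
    by (induction n) (simp_all add: Suc.prems(2))
  have lin: "Vector_Spaces.linear scale scale (A ^^ p)"
    by (rule linear_funpow) fact
  interpret Ap: Vector_Spaces.linear scale scale "A ^^ p" by fact
  have "(\<lambda>x. (A ^^ p) x - x) = ?D ^^ p"
    using funpow_prime_char[OF Suc.prems(1) p] by (simp add: fun_eq_iff)
  then have e: "e = ((\<lambda>x. (A ^^ p) x - x) ^^ (p ^ t)) w"
    by (simp only: Suc.prems(3) funpow_mult power_Suc)
  show ?case
  proof (rule dvd_exponent_step[OF inf p g Suc.prems(1,2) Au Suc.prems(4,5)])
    fix v T P i
    assume "A v = v" "\<And>s. g (v + scale T u + scale s e) = poly P s" "coeff P i \<noteq> 0"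
    then show "p ^ Suc t dvd i"
      by (intro Suc.IH[OF lin inv e fixed[OF Suc.prems(4)], of "v + scale T u"])
        (simp_all add: Ap.add Ap.scale Apu fixed)
  qed (use Suc.prems in auto)
qed

end

subsection \<open>Evaluation on a representation\<close>

context G_module
begin

lemma dual_basis_combination:
  assumes "basis_on I e"
  shows dual_basis_add: "dual_basis I e q (u + v) = dual_basis I e q u + dual_basis I e q v"
    and dual_basis_scale: "dual_basis I e q (scale c v) = c * dual_basis I e q v"
  using assms by (simp_all add: basis_on_def dual_basis_def representation_add representation_scale)

lemma dual_basis_basis:
  assumes "basis_on I e" "q \<in> I" "q' \<in> I"
  shows "dual_basis I e q (e q') = (if q' = q then 1 else 0)"
  using assms representation_basis[of "e ` I" "e q'"]
  by (auto simp: basis_on_def dual_basis_def inj_on_eq_iff)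

lemma dual_basis_sum:
  assumes "basis_on I e"
  shows "dual_basis I e q (\<Sum>i\<in>S. u i) = (\<Sum>i\<in>S. dual_basis I e q (u i))"
proof -
  have "dual_basis I e q 0 = 0"
    using dual_basis_scale[OF assms, of q 0 0] by simp
  then show ?thesis
    by (induction S rule: infinite_finite_induct) (simp_all add: dual_basis_add[OF assms])
qed

lemma sum_dual_basis:
  assumes "basis_on I e" "finite I"
  shows "(\<Sum>q\<in>I. scale (dual_basis I e q v) (e q)) = v"
proof -
  have "(\<Sum>b\<in>e ` I. scale (representation (e ` I) v b) b) = v"
    using assms by (intro sum_representation_eq) (auto simp: basis_on_def)
  then show ?thesis
    using assms by (simp add: basis_on_def dual_basis_def sum.reindex)
qed

text \<open>Ties the substitution in \<open>poly_action\<close> to composition with the inverse of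
  \<open>\<tau>\<close>. Evaluation commutes with substitution, so only the variables need checking,
  by expanding \<open>v\<close> in the basis.\<close>

lemma meval_poly_action:
  assumes "basis_on I e" "finite I" "\<tau> \<in> carrier G"
  shows "meval (\<lambda>q. dual_basis I e q v) (poly_action I e \<tau> f) =
         meval (\<lambda>q. dual_basis I e q (\<rho> (inv \<tau>) v)) f"
proof -
  interpret A: Vector_Spaces.linear scale scale "\<rho> (inv \<tau>)"
    using assms by (intro rho_linear) simp
  have "meval (\<lambda>q. dual_basis I e q v) (linear_form I e (dual_basis I e q \<circ> \<rho> (inv \<tau>))) =
      dual_basis I e q (\<rho> (inv \<tau>) v)" for q
  proof -
    have "dual_basis I e q (\<rho> (inv \<tau>) v) =
        dual_basis I e q (\<rho> (inv \<tau>) (\<Sum>q'\<in>I. scale (dual_basis I e q' v) (e q')))"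
      by (simp only: sum_dual_basis[OF assms(1,2)])
    also have "\<dots> = (\<Sum>q'\<in>I. dual_basis I e q' v * dual_basis I e q (\<rho> (inv \<tau>) (e q')))"
      by (simp add: A.sum A.scale dual_basis_sum[OF assms(1)] dual_basis_scale[OF assms(1)])
    finally show ?thesis
      by (simp add: linear_form_def meval_sum meval_mult mult.commute)
  qed
  then show ?thesis
    by (simp add: poly_action_def meval_subst)
qed

lemma polynomial_fun_meval:
  assumes "basis_on I e"
  shows "polynomial_fun scale (\<lambda>v. meval (\<lambda>q. dual_basis I e q v) f)"
  unfolding polynomial_fun_def
proof (intro allI)
  fix v u w
  let ?x = "\<lambda>v q. dual_basis I e q v"
  \<comment> \<open>The nested linear polynomial is the \<open>q\<close>-th coordinate of v + t u +
    s w, with \<open>t\<close> as inner and \<open>s\<close> as outer variable.\<close>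
  define Q where "Q = (\<Sum>m\<in>Poly_Mapping.keys f. [:[:Poly_Mapping.lookup f m:]:] *
    (\<Prod>q\<in>Poly_Mapping.keys m. [:[:?x v q, ?x u q:], [:?x w q:]:] ^ Poly_Mapping.lookup m q))"
  show "\<exists>Q. \<forall>t s. meval (?x (v + scale t u + scale s w)) f = poly (poly Q [:s:]) t"
    by (rule exI[of _ Q])
      (simp add: Q_def meval_def poly_sum poly_prod dual_basis_combination[OF assms] mult_ac add_ac)
qed

text \<open>On a Jordan block \<open>\<rho> (inv \<sigma>)\<close> - 1 shifts the index by one.
  Hence the last vector is the image of a basis vector under d shifts as soon as n j > d, starting
  at index n j - d.\<close>

lemma funpow_jordan_basis:
  assumes "jordan_basis \<sigma> k n e" "j \<in> {1..k}" "1 \<le> l" "l + i \<le> n j"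
  shows "((\<lambda>x. \<rho> (inv \<sigma>) x - x) ^^ i) (e (l, j)) = e (l + i, j)"
  using assms(4)
proof (induction i)
  case (Suc i)
  then show ?case
    using assms by (simp add: jordan_basis_def)
qed simp

text \<open>The coordinates outside \<open>N\<close> vanish on this subspace, which kills every
  monomial with a variable outside \<open>N\<close>. With the terminal indices as \<open>N\<close>
  the subspace is the fixed space of \<open>\<rho> (inv \<sigma>)\<close>.\<close>

lemma meval_fixed_space:
  assumes e: "basis_on I e" and "finite I" "N \<subseteq> I" "f \<in> polys_in I"
  shows "meval (\<lambda>q. dual_basis I e q (\<Sum>q'\<in>N. scale (y q') (e q'))) f =
    (\<Sum>m\<in>{m\<in>Poly_Mapping.keys f. Poly_Mapping.keys m \<subseteq> N}.
       Poly_Mapping.lookup f m * (\<Prod>q\<in>N. y q ^ Poly_Mapping.lookup m q))"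
proof -
  let ?v = "\<Sum>q'\<in>N. scale (y q') (e q')"
  have N: "finite N" using assms finite_subset by blast
  have x: "dual_basis I e q ?v = (if q \<in> N then y q else 0)" if "q \<in> I" for q
  proof -
    have "dual_basis I e q ?v = (\<Sum>q'\<in>N. if q' = q then y q' else 0)"
      unfolding dual_basis_sum[OF e] dual_basis_scale[OF e]
      using that assms by (intro sum.cong) (auto simp: dual_basis_basis)
    then show ?thesis using N by simp
  qed
  have "(\<Prod>q\<in>Poly_Mapping.keys m. dual_basis I e q ?v ^ Poly_Mapping.lookup m q) =
      (if Poly_Mapping.keys m \<subseteq> N then \<Prod>q\<in>N. y q ^ Poly_Mapping.lookup m q else 0)"
    if "m \<in> Poly_Mapping.keys f" for m
  proof (cases "Poly_Mapping.keys m \<subseteq> N")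
    case True
    have "(\<Prod>q\<in>Poly_Mapping.keys m. dual_basis I e q ?v ^ Poly_Mapping.lookup m q) =
        (\<Prod>q\<in>Poly_Mapping.keys m. y q ^ Poly_Mapping.lookup m q)"
      using True assms(3) by (intro prod.cong) (auto simp: x subset_iff)
    then show ?thesis
      using True N by (simp add: monomial_superset)
  next
    case False
    then obtain q where q: "q \<in> Poly_Mapping.keys m" "q \<notin> N" by blast
    have "q \<in> I" using q that assms(4) by (auto simp: polys_in_def)
    then have "dual_basis I e q ?v ^ Poly_Mapping.lookup m q = 0"
      using q x[of q] by (simp add: in_keys_iff)
    then show ?thesis
      using q False by (simp add: prod_zero bexI[of _ q])
  qed
  then have "meval (\<lambda>q. dual_basis I e q ?v) f = (\<Sum>m\<in>Poly_Mapping.keys f.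
      if Poly_Mapping.keys m \<subseteq> N
      then Poly_Mapping.lookup f m * (\<Prod>q\<in>N. y q ^ Poly_Mapping.lookup m q) else 0)"
    unfolding meval_def by (intro sum.cong) auto
  then show ?thesis
    by (simp add: sum.inter_filter)
qed

end

section \<open>Exponents of the terminal variables\<close>

theorem lemma3:
  fixes p r k s :: nat and n a :: "nat \<Rightarrow> nat"
    and G :: "('g, 'b) monoid_scheme" and \<sigma> :: 'g
    and scale :: "'a::alg_closed_field \<Rightarrow> 'v::ab_group_add \<Rightarrow> 'v"
    and \<rho> :: "'g \<Rightarrow> 'v \<Rightarrow> 'v" and e :: "nat \<times> nat \<Rightarrow> 'v"
    and f :: "(nat \<times> nat, 'a) mpoly"
  assumes "CHAR('a) = p" and "p > 0" and "r \<ge> 1"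
    and "group G" and "\<sigma> \<in> carrier G" and "carrier G = generate G {\<sigma>}" and "order G = p ^ r"
    and "G_module G scale \<rho>"
    and "\<forall>j\<in>{1..k}. 1 \<le> n j \<and> n j \<le> p ^ r"
    and "G_module.jordan_basis G scale \<rho> \<sigma> k n e"
    and "s \<le> r"
    and "f \<in> G_module.invariants G scale \<rho> (block_index k n) e"
    and "Poly_Mapping.lookup f (terminal_monomial k n a) \<noteq> 0"
  shows "\<forall>j\<in>J p k n s. p ^ s dvd a j"
proof
  fix j assume j: "j \<in> J p k n s"
  interpret G_module G scale \<rho> by fact
  let ?I = "block_index k n"
  let ?A = "\<rho> (inv\<^bsub>G\<^esub> \<sigma>)"
  define g where "g v = meval (\<lambda>q. dual_basis ?I e q v) f" for v
  define N where "N = (\<lambda>j. (n j, j)) ` {1..k}"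
  define m0 where "m0 = terminal_monomial k n a"
  define K where "K = {m\<in>Poly_Mapping.keys f. Poly_Mapping.keys m \<subseteq> N}"
  have p: "prime p" "CHAR('a) = p"
    using assms(1,2) prime_CHAR_semidom[where 'a = 'a] by auto
  have e: "basis_on ?I e"
    using assms(10) by (simp add: jordan_basis_def)
  have f: "f \<in> polys_in ?I" "poly_action ?I e \<sigma> f = f"
    using assms(5,12) by (auto simp: invariants_def)
  have N: "finite N" "N \<subseteq> ?I"
    using assms(9) by (auto simp: N_def block_index_def)
  have g: "polynomial_fun scale g"
    unfolding g_def by (rule polynomial_fun_meval[OF e])
  have inv: "g (?A v) = g v" for v
    using meval_poly_action[OF e finite_block_index assms(5), of v f] f by (simp add: g_def)
  have A: "Vector_Spaces.linear scale scale ?A"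
    using assms(5) by (intro rho_linear) simp
  interpret A: Vector_Spaces.linear scale scale ?A by (rule A)
  have fixed: "?A (e q) = e q" if "q \<in> N" for q
    using that assms(10) by (auto simp: N_def jordan_basis_def)
  have gN: "g (\<Sum>q\<in>N. scale (y q) (e q)) =
      (\<Sum>m\<in>K. Poly_Mapping.lookup f m * (\<Prod>q\<in>N. y q ^ Poly_Mapping.lookup m q))" for y
    unfolding g_def K_def by (rule meval_fixed_space[OF e finite_block_index N(2) f(1)])
  have m0_lookup: "Poly_Mapping.lookup m0 (n j, j) = a j" if "j \<in> {1..k}" for j
  proof -
    have "Poly_Mapping.lookup m0 (n j, j) = (\<Sum>i\<in>{1..k}. if i = j then a i else 0)"
      unfolding m0_def terminal_monomial_def lookup_sum
      by (intro sum.cong) (auto simp: lookup_single when_def)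
    then show ?thesis using that by simp
  qed
  have m0_keys: "Poly_Mapping.keys m0 \<subseteq> N"
    using keys_sum[of "\<lambda>j. Poly_Mapping.single (n j, j) (a j)" "{1..k}"]
    by (auto simp: m0_def terminal_monomial_def N_def split: if_splits)
  show "p ^ s dvd a j"
  proof (cases s)
    case (Suc t)
    \<comment> \<open>Now s - 1 is \<open>t\<close>, so the real power in \<open>J\<close> is
      \<open>p ^ t\<close>; the remaining case s = 0 is divisibility by 1.\<close>
    have jk: "j \<in> {1..k}" and "real (p ^ t) < real (n j)"
      using j by (auto simp: J_def Suc)
    then have nj: "p ^ t < n j" by linarith
    define q0 where "q0 = (n j, j)"
    have q0: "q0 \<in> N" using jk by (auto simp: q0_def N_def)
    have eq0: "e q0 = ((\<lambda>x. ?A x - x) ^^ (p ^ t)) (e (n j - p ^ t, j))"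
      using nj by (simp add: funpow_jordan_basis[OF assms(10) jk] q0_def)
    show ?thesis
    proof (rule ccontr)
      assume nd: "\<not> p ^ s dvd a j"
      define K' where "K' = {m\<in>K. Poly_Mapping.lookup m q0 = a j}"
      have "finite K" by (simp add: K_def)
      \<comment> \<open>With the other terminal coordinates frozen at \<open>x\<close>, this sum is
        the coefficient of degree \<open>a j\<close> along \<open>e q0\<close>, which vanishes
        because \<open>p ^ s\<close> does not divide \<open>a j\<close>.\<close>
      have "(\<Sum>m\<in>K'. Poly_Mapping.lookup f m *
          (\<Prod>q\<in>N - {q0}. x q ^ Poly_Mapping.lookup m q)) = 0" for x
      proof -
        define c where "c m = Poly_Mapping.lookup f m *
          (\<Prod>q\<in>N - {q0}. x q ^ Poly_Mapping.lookup m q)" for m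
        define P where "P = (\<Sum>m\<in>K. monom (c m) (Poly_Mapping.lookup m q0))"
        define v where "v = (\<Sum>q\<in>N - {q0}. scale (x q) (e q))"
        have "?A v = v"
          by (simp add: v_def A.sum A.scale fixed)
        moreover have "g (v + scale s' (e q0)) = poly P s'" for s'
        proof -
          have "v + scale s' (e q0) = (\<Sum>q\<in>N. scale ((x(q0 := s')) q) (e q))"
            using N q0 by (simp add: v_def sum.remove[of N q0] add.commute)
          moreover have "Poly_Mapping.lookup f m *
              (\<Prod>q\<in>N. (x(q0 := s')) q ^ Poly_Mapping.lookup m q) =
              c m * s' ^ Poly_Mapping.lookup m q0" for m
            using N q0 by (simp add: c_def prod.remove[of N q0] mult_ac)
          ultimately show ?thesis
            by (simp only: gN) (simp add: P_def poly_sum poly_monom)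
        qed
        ultimately have "coeff P (a j) = 0"
          using dvd_exponent_fixed_direction[OF alg_closed_infinite p g A inv eq0 fixed[OF q0],
              of v P "a j"] nd Suc by blast
        then show ?thesis
          using \<open>finite K\<close> by (simp add: P_def coeff_sum_monom_fun K'_def c_def)
      qed
      \<comment> \<open>As \<open>x\<close> was arbitrary, coefficients can be compared in the other
        terminal variables. Members of \<open>K'\<close> involve no further variables, so
        \<open>m0\<close> alone is singled out.\<close>
      then have "(\<Sum>m\<in>{m\<in>K'. \<forall>q\<in>N - {q0}. Poly_Mapping.lookup m q = Poly_Mapping.lookup m0 q}.
          Poly_Mapping.lookup f m) = 0"
        using N \<open>finite K\<close>
        by (intro sum_monomials_eq_0[OF alg_closed_infinite]) (auto simp: K'_def)
      moreover have "{m\<in>K'. \<forall>q\<in>N - {q0}. Poly_Mapping.lookup m q = Poly_Mapping.lookup m0 q} = {m0}"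
      proof -
        have "m = m0" if "m \<in> K'"
          "\<forall>q\<in>N - {q0}. Poly_Mapping.lookup m q = Poly_Mapping.lookup m0 q" for m
        proof (rule poly_mapping_eqI)
          fix q show "Poly_Mapping.lookup m q = Poly_Mapping.lookup m0 q"
          proof (cases "q \<in> N")
            case True
            then show ?thesis
              using that m0_lookup[OF jk] by (cases "q = q0") (auto simp: K'_def q0_def)
          next
            case False
            then have "q \<notin> Poly_Mapping.keys m" "q \<notin> Poly_Mapping.keys m0"
              using that m0_keys by (auto simp: K'_def K_def)
            then show ?thesis by (simp add: in_keys_iff)
          qed
        qed
        moreover have "m0 \<in> K'"
          using m0_keys m0_lookup[OF jk] assms(13)
          by (simp add: K'_def K_def q0_def in_keys_iff m0_def)
        ultimately show ?thesis by blast
      qed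
      ultimately show False
        using assms(13) by (simp add: m0_def)
    qed
  qed simp
qed

end
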